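(* Let $P$ and $\tilde P$ be stochastic matrices on a finite set $\mathcal V$. Let $P$ be irreducible with invariant probability vector $\pi$ and mixing time $\tau_{\mathrm{mix}}$, and let $\tilde\pi$ be an invariant probability vector of $\tilde P$ (i.e. $\tilde\pi=\tilde\pi\tilde P$; $\tilde P$ need not be irreducible and $\tilde\pi$ need not be unique). Then, for every $\mathcal W\subseteq\mathcal V$ such that $\mathrm{supp}(\tilde P-P)\subseteq\mathcal W$, $$\|\tilde\pi-\pi\|\le\Psi\left(\frac{\tau_{\mathrm{mix}}}{\tilde\gamma_{\mathcal W}\cdot\tau^*_{\mathcal W}}\right).$$
   Context: A probability vector is a nonnegative row vector indexed by $\mathcal V$ with entries summing to $1$; a stochastic matrix is a nonnegative square matrix indexed by $\mathcal V$ with all row sums equal to $1$. A stochastic matrix $P$ is irreducible if the directed graph on $\mathcal V$ with a link $(u,v)$ whenever $P_{uv}>0$ is strongly connected. A probability vector $\mu$ is invariant for $P$ if $\mu P=\mu$. For a matrix $A$, $\mathrm{supp}(A):=\{v\in\mathcal V: A_{v,\cdot}\neq 0\}$ is the set of (indices of) its nonzero rows. The total variation distance between probability vectors is $\|\mu-\nu\|:=\frac12\sum_{v\in\mathcal V}|\mu_v-\nu_v|$. The function $\Psi:[0,+\infty)\to[0,1]$ is defined by $\Psi(x)=x\ln(e^2/x)$ for $x\le x^*$ (with $\Psi(0)=0$) and $\Psi(x)=1$ for $x>x^*$, where $x^*=0.31784\ldots$ is the smallest positive solution of $x\ln(e^2/x)=1$. We also set $\Psi(+\infty)=1$. The mixing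 time of $P$ is $\tau_{\mathrm{mix}}:=\inf\{t\ge1 \text{ integer}: \max_{u,v\in\mathcal V}\|P^t_{u,\cdot}-P^t_{v,\cdot}\|\le 1/e\}$ (equal to $+\infty$ if there is no such $t$). Entrance time: the numbers $\tau^u_{\mathcal W}$, $u\in\mathcal V$, are the solution of $\tau^u_{\mathcal W}=0$ for $u\in\mathcal W$ and $\tau^u_{\mathcal W}=1+\sum_{v\in\mathcal V}P_{uv}\tau^v_{\mathcal W}$ for $u\in\mathcal V\setminus\mathcal W$; equivalently, $\tau^u_{\mathcal W}$ is the expected hitting time of $\mathcal W$ for a Markov chain with transition matrix $P$ started at $u$ (so it is $+\infty$ if $\mathcal W=\emptyset$). Then $\tau^*_{\mathcal W}:=\min_{u\in\mathcal V\setminus\mathcal W}\tau^u_{\mathcal W}$. Exit probability: $$\tilde\gamma_{\mathcal W}:=\sup_{t\ge1}\ \min_{w\in\mathcal W:\ \tilde\pi_w>0}\ \frac1t\sum_{k=1}^t\ \sum_{\substack{\xi_0=w,\ \xi_k\in\mathcal V\setminus\mathcal W\\ \xi_1,\ldots,\xi_{k-1}\in\mathcal W}}\ \prod_{1\le l\le k}\tilde P_{\xi_{l-1}\xi_l},$$ with $t$ ranging over positive integers; i.e. $\tilde\gamma_{\mathcal W}=\sup_{t\ge1}\min_{w\in\mathcal W,\tilde\pi_w>0}\frac1t\,\mathbb P_w(\tilde T_{\mathcal V\setminus\mathcal W}\le t)$, where $\tilde T_{\mathcal V\setminus\mathcal W}$ is the hitting time of $\mathcal V\setminus\mathcal W$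 for a Markov chain with transition matrix $\tilde P$ started at $w$. Conventions for degenerate cases: a minimum over the empty set is $+\infty$; if $\tilde\gamma_{\mathcal W}=0$ or $\tau_{\mathrm{mix}}=+\infty$, the argument of $\Psi$ is read as $+\infty$ (so the bound is trivial); otherwise division by $+\infty$ gives $0$. *)

theory Defs
  imports "HOL-Analysis.Analysis"
begin

definition prob_vector :: "real ^ 'v \<Rightarrow> bool" where
  "prob_vector \<mu> \<longleftrightarrow> (\<forall>v. 0 \<le> \<mu> $ v) \<and> (\<Sum>v\<in>UNIV. \<mu> $ v) = 1"

definition stochastic_matrix :: "real ^ 'v ^ 'v \<Rightarrow> bool" where
  "stochastic_matrix P \<longleftrightarrow> (\<forall>u v. 0 \<le> P $ u $ v) \<and> (\<forall>u. (\<Sum>v\<in>UNIV. P $ u $ v) = 1)"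

definition irreducible_matrix :: "real ^ 'v ^ 'v \<Rightarrow> bool" where
  "irreducible_matrix P \<longleftrightarrow> (\<forall>u v. (u, v) \<in> {(a, b). 0 < P $ a $ b}\<^sup>*)"

definition invariant_vector :: "real ^ 'v ^ 'v \<Rightarrow> real ^ 'v \<Rightarrow> bool" where
  "invariant_vector P \<mu> \<longleftrightarrow> \<mu> v* P = \<mu>"

definition row_supp :: "real ^ 'v ^ 'v \<Rightarrow> 'v set" where
  "row_supp A = {v. row v A \<noteq> 0}"

definition tv_dist :: "real ^ 'v \<Rightarrow> real ^ 'v \<Rightarrow> real" where
  "tv_dist \<mu> \<nu> = 1 / 2 * (\<Sum>v\<in>UNIV. \<bar>\<mu> $ v - \<nu> $ v\<bar>)"

definition Psi_threshold :: real where
  "Psi_threshold = (LEAST x. 0 < x \<and> x * ln ((exp 1)\<^sup>2 / x) = 1)"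

text \<open>At \<open>x = 0\<close> the first branch evaluates to \<open>0\<close>, and \<open>x = \<infinity>\<close> falls into the second one.\<close>

definition Psi :: "ennreal \<Rightarrow> real" where
  "Psi x = (if x \<le> ennreal Psi_threshold
            then enn2real x * ln ((exp 1)\<^sup>2 / enn2real x) else 1)"

definition matrix_pow :: "real ^ 'v ^ 'v \<Rightarrow> nat \<Rightarrow> real ^ 'v ^ 'v" where
  "matrix_pow P t = ((\<lambda>A. A ** P) ^^ t) (mat 1)"

text \<open>Infima over the empty set are \<open>\<infinity>\<close> in \<^typ>\<open>ennreal\<close>, as required below in all
  degenerate cases; over nonempty sets all infima below are attained.\<close>

definition mixing_time :: "real ^ 'v ^ 'v \<Rightarrow> ennreal" where
  "mixing_time P = (INF t \<in> {t::nat. 1 \<le> t \<and>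
     (MAX (u, v) \<in> UNIV. tv_dist (row u (matrix_pow P t)) (row v (matrix_pow P t))) \<le> 1 / exp 1}.
     of_nat t)"

definition entrance_equations :: "real ^ 'v ^ 'v \<Rightarrow> 'v set \<Rightarrow> ('v \<Rightarrow> real) \<Rightarrow> bool" where
  "entrance_equations P W \<tau> \<longleftrightarrow>
     (\<forall>u\<in>W. \<tau> u = 0) \<and> (\<forall>u\<in>- W. \<tau> u = 1 + (\<Sum>v\<in>UNIV. P $ u $ v * \<tau> v))"

text \<open>For \<open>W \<noteq> {}\<close> the definite description is meant for irreducible stochastic \<open>P\<close>; see
  \<open>entrance_equations_ex1\<close> and \<open>entrance_equations_nonneg\<close> below.\<close>

definition entrance_time :: "real ^ 'v ^ 'v \<Rightarrow> 'v set \<Rightarrow> 'v \<Rightarrow> ennreal" where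
  "entrance_time P W u =
     (if W = {} then \<infinity> else ennreal ((THE \<tau>. entrance_equations P W \<tau>) u))"

definition min_entrance_time :: "real ^ 'v ^ 'v \<Rightarrow> 'v set \<Rightarrow> ennreal" where
  "min_entrance_time P W = (INF u \<in> - W. entrance_time P W u)"

definition exit_paths :: "'v set \<Rightarrow> 'v \<Rightarrow> nat \<Rightarrow> (nat \<Rightarrow> 'v) set" where
  "exit_paths W w k =
     {\<xi> \<in> {..k} \<rightarrow>\<^sub>E UNIV. \<xi> 0 = w \<and> \<xi> k \<in> - W \<and> (\<forall>i\<in>{1..<k}. \<xi> i \<in> W)}"

definition exit_prob :: "real ^ 'v ^ 'v \<Rightarrow> real ^ 'v \<Rightarrow> 'v set \<Rightarrow> ennreal" where
  "exit_prob Q \<mu> W =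
     (SUP t \<in> {1::nat..}. INF w \<in> {w \<in> W. 0 < \<mu> $ w}.
        ennreal (1 / real t * (\<Sum>k = 1..t. \<Sum>\<xi> \<in> exit_paths W w k.
                   \<Prod>l = 1..k. Q $ \<xi> (l - 1) $ \<xi> l)))"

text \<open>The case distinction is needed because \<open>\<infinity> / \<infinity> = 0\<close> in \<^typ>\<open>ennreal\<close>.\<close>

definition Psi_argument :: "ennreal \<Rightarrow> ennreal \<Rightarrow> ennreal \<Rightarrow> ennreal" where
  "Psi_argument \<tau>mix \<gamma> \<tau> = (if \<gamma> = 0 \<or> \<tau>mix = \<infinity> then \<infinity> else \<tau>mix / (\<gamma> * \<tau>))"

lemma subharmonic_nonpos:
  fixes P :: "real ^ 'v ^ 'v" and d :: "'v \<Rightarrow> real"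
  assumes P: "stochastic_matrix P" "irreducible_matrix P" and W: "W \<noteq> {}"
    and dW: "\<And>u. u \<in> W \<Longrightarrow> d u \<le> 0"
    and dP: "\<And>u. u \<notin> W \<Longrightarrow> d u \<le> (\<Sum>v\<in>UNIV. P $ u $ v * d v)"
  shows "d u \<le> 0"
proof -
  define M where "M = Max (range d)"
  have le: "d v \<le> M" for v unfolding M_def by simp
  have "M \<in> range d" unfolding M_def by (rule Max_in) auto
  then obtain a where a: "d a = M" by auto
  have step: "d v = M" if "d b = M" "b \<notin> W" "0 < P $ b $ v" for b v
  proof (rule ccontr)
    assume "d v \<noteq> M"
    with le have "d v < M" by (metis less_le)
    have "(\<Sum>v\<in>UNIV. P $ b $ v * d v) < (\<Sum>v\<in>UNIV. P $ b $ v * M)"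
    proof (rule sum_strict_mono_ex1)
      show "\<forall>x\<in>UNIV. P $ b $ x * d x \<le> P $ b $ x * M"
        using P(1) le by (auto simp: stochastic_matrix_def intro: mult_left_mono)
      show "\<exists>x\<in>UNIV. P $ b $ x * d x < P $ b $ x * M"
        using \<open>d v < M\<close> that(3) by (auto intro!: exI[of _ v])
    qed simp
    also have "\<dots> = M"
      using P(1) by (simp add: stochastic_matrix_def sum_distrib_right[symmetric])
    finally show False using dP[of b] that by simp
  qed
  have "\<exists>w\<in>W. d w = M"
  proof (rule ccontr)
    assume no: "\<not> (\<exists>w\<in>W. d w = M)"
    from W obtain w where w: "w \<in> W" by auto
    have "(a, w) \<in> {(a, b). 0 < P $ a $ b}\<^sup>*"
      using P(2) by (auto simp: irreducible_matrix_def)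
    then have "d w = M"
      by (induction rule: rtrancl_induct) (use a no step in auto)
    with no w show False by auto
  qed
  with dW have "M \<le> 0" by auto
  with le[of u] show ?thesis by linarith
qed

lemma entrance_equations_ex1:
  fixes P :: "real ^ 'v ^ 'v"
  assumes P: "stochastic_matrix P" "irreducible_matrix P" and W: "W \<noteq> {}"
  shows "\<exists>!\<tau>. entrance_equations P W \<tau>"
proof -
  define L :: "real ^ 'v \<Rightarrow> real ^ 'v" where
    "L x = (\<chi> u. if u \<in> W then x $ u else x $ u - (\<Sum>v\<in>UNIV. P $ u $ v * x $ v))" for x
  define r :: "real ^ 'v" where "r = (\<chi> u. if u \<in> W then 0 else 1)"
  have L_iff: "L (\<chi> u. \<tau> u) = r \<longleftrightarrow> entrance_equations P W \<tau>" for \<tau>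
    by (auto simp: L_def r_def entrance_equations_def vec_eq_iff algebra_simps)
  have lin: "linear L"
    by (rule linearI)
      (auto simp: L_def vec_eq_iff algebra_simps sum.distrib sum_distrib_left)
  have "x = 0" if "L x = 0" for x
  proof -
    have zero: "x $ u = 0" if "u \<in> W" for u
      using \<open>L x = 0\<close> that by (auto simp: L_def vec_eq_iff split: if_splits)
    have harm: "x $ u = (\<Sum>v\<in>UNIV. P $ u $ v * x $ v)" if "u \<notin> W" for u
      using \<open>L x = 0\<close> that by (auto simp: L_def vec_eq_iff split: if_splits)
    have "x $ u \<le> 0" for u
      by (rule subharmonic_nonpos[OF P W, of "\<lambda>u. x $ u"]) (use zero harm in auto)
    moreover have "- x $ u \<le> 0" for u
      by (rule subharmonic_nonpos[OF P W, of "\<lambda>u. - x $ u"])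
        (use zero harm in \<open>auto simp: sum_negf\<close>)
    ultimately show ?thesis by (simp add: vec_eq_iff) (metis antisym neg_le_0_iff_le)
  qed
  then have inj: "inj L" using lin by (simp add: linear_injective_0)
  then have "surj L" using lin linear_injective_imp_surjective by blast
  then obtain x where x: "L x = r" by (metis surj_def)
  show ?thesis
  proof
    show "entrance_equations P W (\<lambda>u. x $ u)" using x L_iff[of "\<lambda>u. x $ u"] by simp
    fix \<tau> assume "entrance_equations P W \<tau>"
    then have "(\<chi> u. \<tau> u) = x" using x L_iff inj by (metis injD)
    then show "\<tau> = (\<lambda>u. x $ u)" by auto
  qed
qed

lemma entrance_equations_nonneg:
  fixes P :: "real ^ 'v ^ 'v"
  assumes P: "stochastic_matrix P" "irreducible_matrix P" and W: "W \<noteq> {}"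
    and \<tau>: "entrance_equations P W \<tau>"
  shows "0 \<le> \<tau> u"
proof -
  have "- \<tau> u \<le> 0"
    by (rule subharmonic_nonpos[OF P W, of "\<lambda>u. - \<tau> u"])
      (use \<tau> in \<open>auto simp: entrance_equations_def sum_negf\<close>)
  then show ?thesis by simp
qed

lemma Psi_threshold_works:
  "0 < Psi_threshold" "Psi_threshold < 1"
  "Psi_threshold * ln ((exp 1)\<^sup>2 / Psi_threshold) = 1"
  "\<And>x. 0 < x \<Longrightarrow> x * ln ((exp 1)\<^sup>2 / x) = 1 \<Longrightarrow> Psi_threshold \<le> x"
proof -
  define f :: "real \<Rightarrow> real" where "f = (\<lambda>x. x * ln ((exp 1)\<^sup>2 / x))"
  have f: "f x = x * (2 - ln x)" if "0 < x" for x
    using that by (simp add: f_def ln_div ln_realpow)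
  have mono: "f x < f y" if "0 < x" "x < y" "y \<le> 1" for x y
  proof -
    have "\<exists>D. ((\<lambda>x. x * (2 - ln x)) has_real_derivative D) (at z) \<and> 0 < D"
      if "x \<le> z" "z \<le> y" for z
    proof (intro exI conjI)
      show "((\<lambda>x. x * (2 - ln x)) has_real_derivative (1 - ln z)) (at z)"
        using that \<open>0 < x\<close> by (auto intro!: derivative_eq_intros)
      show "0 < 1 - ln z"
        using that \<open>0 < x\<close> \<open>y \<le> 1\<close> ln_le_zero_iff[of z] by linarith
    qed
    from DERIV_pos_imp_increasing[OF \<open>x < y\<close> this]
    show ?thesis using that f by simp
  qed
  have "(2::real) ^ 3 \<le> exp 1 ^ 3"
    using exp_ge_add_one_self[of "1::real"] by (intro power_mono) auto
  then have "8 \<le> exp (3::real)" by (simp flip: exp_of_nat_mult)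
  moreover have "f (exp (-3)) = 5 / exp 3" by (simp add: f exp_minus divide_inverse ln_inverse)
  ultimately have lo: "f (exp (-3)) < 1" by simp
  have hi: "f 1 = 2" using f[of 1] by simp
  have "\<exists>x\<ge>exp (-3). x \<le> 1 \<and> f x = 1"
  proof (rule IVT')
    show "f (exp (-3)) \<le> 1" "1 \<le> f 1" "exp (-3) \<le> (1::real)" using lo hi by auto
    show "continuous_on {exp (-3)..1} f"
      unfolding f_def
      by (intro continuous_intros ballI) (use exp_gt_zero[of "-3::real"] in \<open>auto simp del: exp_gt_zero\<close>)
  qed
  then obtain x where x: "0 < x" "x \<le> 1" "f x = 1"
    by (meson exp_gt_zero less_le_trans)
  have least: "x \<le> y" if "0 < y" "f y = 1" for y
    using mono[of y x] that x by (metis linorder_not_le less_irrefl)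
  have "x < 1" using x hi by (cases "x = 1") auto
  have "Psi_threshold = x"
    unfolding Psi_threshold_def using x least by (intro Least_equality) (auto simp: f_def)
  then show "0 < Psi_threshold" "Psi_threshold < 1"
    "Psi_threshold * ln ((exp 1)\<^sup>2 / Psi_threshold) = 1"
    "\<And>x. 0 < x \<Longrightarrow> x * ln ((exp 1)\<^sup>2 / x) = 1 \<Longrightarrow> Psi_threshold \<le> x"
    using x least \<open>x < 1\<close> by (auto simp: f_def)
qed

end

theory Submission
  imports Defs
begin

text \<open>
  Two estimates are combined. First, \<open>\<nu> = \<pi>t - \<pi>\<close> has zero sum, so for \<open>t = \<tau>mix\<close>
  the vector \<open>\<nu> P^t\<close> has at most \<open>1/e\<close> times the norm of \<open>\<nu>\<close>, whereas
  \<open>\<nu> - \<nu> P^t = \<pi>t - \<pi>t P^t\<close> has norm at most \<open>t \<pi>t(W)\<close>, since each step with \<open>P\<close> in place of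
  \<open>Pt\<close> costs at most \<open>\<pi>t(W)\<close>. Hence \<open>\<parallel>\<nu>\<parallel> \<le> 2 \<tau>mix \<pi>t(W)\<close>.

  Second, let \<open>F\<close> be the stationary flow of \<open>Pt\<close> from \<open>W\<close> to its complement. A stationary chain
  started in \<open>W\<close> leaves \<open>W\<close> within \<open>t\<close> steps with probability at most \<open>t F\<close>, so
  \<open>\<gamma> \<pi>t(W) \<le> F\<close>; and the mass outside \<open>W\<close> equals the flow times the mean time spent outside, so
  \<open>F \<tau>* \<le> 1\<close>. Thus \<open>\<pi>t(W) \<le> 1 / (\<gamma> \<tau>*)\<close>, and \<open>2 x \<le> x ln (e\<^sup>2 / x)\<close> for \<open>x \<le> 1\<close>.
\<close>

section \<open>The \<open>l1\<close> norm and its contraction by matrices\<close>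

lemma vector_matrix_mult_nth: "(x v* A) $ j = (\<Sum>i\<in>UNIV. x $ i * A $ i $ j)"
  for x :: "real ^ 'n" and A :: "real ^ 'm ^ 'n"
  by (simp add: vector_matrix_mult_def mult.commute)

definition l1_norm :: "real ^ 'v \<Rightarrow> real" where
  "l1_norm x = (\<Sum>v\<in>UNIV. \<bar>x $ v\<bar>)"

lemma tv_dist_eq_l1_norm: "tv_dist \<mu> \<nu> = l1_norm (\<mu> - \<nu>) / 2"
  by (simp add: tv_dist_def l1_norm_def)

lemma l1_norm_nonneg: "0 \<le> l1_norm x"
  by (simp add: l1_norm_def sum_nonneg)

lemma l1_norm_triangle: "l1_norm (x + y) \<le> l1_norm x + l1_norm y"
  unfolding l1_norm_def sum.distrib[symmetric] by (rule sum_mono) (simp add: abs_triangle_ineq)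

lemma l1_norm_minus_commute: "l1_norm (x - y) = l1_norm (y - x)"
  by (simp add: l1_norm_def abs_minus_commute)

lemma l1_norm_prob_vector: "prob_vector \<mu> \<Longrightarrow> l1_norm \<mu> = 1"
  by (simp add: l1_norm_def prob_vector_def)

lemma tv_dist_le_1:
  assumes "prob_vector \<mu>" "prob_vector \<nu>"
  shows "tv_dist \<mu> \<nu> \<le> 1"
proof -
  have "l1_norm (- \<nu>) = l1_norm \<nu>" by (simp add: l1_norm_def)
  then show ?thesis
    using l1_norm_triangle[of \<mu> "- \<nu>"] assms by (simp add: tv_dist_eq_l1_norm l1_norm_prob_vector)
qed

lemma prob_vector_row: "stochastic_matrix P \<Longrightarrow> prob_vector (row u P)"
  by (simp add: stochastic_matrix_def prob_vector_def row_def)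

text \<open>The row norms stay separate in this bound, because in the perturbation estimate the rows
  outside \<open>W\<close> vanish while the others have norm at most 2.\<close>

lemma l1_norm_vector_matrix_mult_le:
  "l1_norm (x v* A) \<le> (\<Sum>i\<in>UNIV. \<bar>x $ i\<bar> * l1_norm (row i A))"
proof -
  have "l1_norm (x v* A) \<le> (\<Sum>j\<in>UNIV. \<Sum>i\<in>UNIV. \<bar>x $ i\<bar> * \<bar>A $ i $ j\<bar>)"
    unfolding l1_norm_def vector_matrix_mult_nth
    by (rule sum_mono) (metis (no_types, lifting) abs_mult sum.cong sum_abs)
  also have "\<dots> = (\<Sum>i\<in>UNIV. \<Sum>j\<in>UNIV. \<bar>x $ i\<bar> * \<bar>A $ i $ j\<bar>)"
    by (rule sum.swap)
  finally show ?thesis by (simp add: l1_norm_def row_def sum_distrib_left)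
qed

lemma l1_norm_stochastic_le:
  assumes "stochastic_matrix P"
  shows "l1_norm (x v* P) \<le> l1_norm x"
  using l1_norm_vector_matrix_mult_le[of x P]
  by (simp add: l1_norm_prob_vector[OF prob_vector_row[OF assms]] l1_norm_def[of x])

text \<open>With \<open>p\<close>, \<open>q\<close> the positive and negative parts of \<open>x\<close>, both of mass \<open>m\<close>, the vector
  \<open>m (x A)\<close> is the combination of the row differences of \<open>A\<close> with weights \<open>p u * q v\<close>.\<close>

lemma l1_norm_contraction:
  assumes sum0: "(\<Sum>i\<in>UNIV. x $ i) = 0"
    and D: "\<And>u v. tv_dist (row u A) (row v A) \<le> D"
  shows "l1_norm (x v* A) \<le> D * l1_norm x"
proof -
  define p where "p i = max (x $ i) 0" for i
  define q where "q i = max (- x $ i) 0" for i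
  define m where "m = (\<Sum>i\<in>UNIV. p i)"
  have pq: "x $ i = p i - q i" "\<bar>x $ i\<bar> = p i + q i" "0 \<le> p i" "0 \<le> q i" for i
    by (auto simp: p_def q_def)
  have q: "(\<Sum>i\<in>UNIV. q i) = m"
    using sum0 by (simp add: pq(1) sum_subtractf m_def)
  have nx: "l1_norm x = 2 * m"
    using q by (simp add: l1_norm_def pq(2) sum.distrib m_def)
  have m0: "0 \<le> m" unfolding m_def by (rule sum_nonneg) (rule pq)
  show ?thesis
  proof (cases "m = 0")
    case True
    then have "x $ i = 0" for i
      using nx by (simp add: l1_norm_def sum_nonneg_eq_0_iff)
    then have "x = 0" by (simp add: vec_eq_iff)
    then show ?thesis by (simp add: l1_norm_def)
  next
    case False
    \<comment> \<open>Each term of the double sum involves only one of \<open>u\<close>,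
      \<open>v\<close> through \<open>A\<close>, so summing the other weight to \<open>m\<close>
      leaves \<open>m\<close> times the contributions of \<open>p\<close> and \<open>q\<close> to
      \<open>x v* A\<close>.\<close>
    have eq: "m * (x v* A) $ j = (\<Sum>u\<in>UNIV. \<Sum>v\<in>UNIV. p u * q v * (A $ u $ j - A $ v $ j))" for j
    proof -
      have "(\<Sum>u\<in>UNIV. \<Sum>v\<in>UNIV. p u * q v * (A $ u $ j - A $ v $ j))
          = (\<Sum>u\<in>UNIV. \<Sum>v\<in>UNIV. (p u * A $ u $ j) * q v)
            - (\<Sum>u\<in>UNIV. \<Sum>v\<in>UNIV. p u * (q v * A $ v $ j))"
        by (simp add: sum_subtractf[symmetric] algebra_simps)
      also have "\<dots> = (\<Sum>u\<in>UNIV. p u * A $ u $ j) * (\<Sum>v\<in>UNIV. q v)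
            - (\<Sum>u\<in>UNIV. p u) * (\<Sum>v\<in>UNIV. q v * A $ v $ j)"
        by (simp only: sum_product)
      also have "\<dots> = m * ((\<Sum>u\<in>UNIV. p u * A $ u $ j) - (\<Sum>v\<in>UNIV. q v * A $ v $ j))"
        by (simp add: q m_def[symmetric] algebra_simps)
      finally show ?thesis
        by (simp add: vector_matrix_mult_nth pq(1) sum_subtractf algebra_simps)
    qed
    have "m * l1_norm (x v* A) = (\<Sum>j\<in>UNIV. \<bar>m * (x v* A) $ j\<bar>)"
      using m0 by (simp add: l1_norm_def abs_mult sum_distrib_left)
    also have "\<dots> \<le> (\<Sum>j\<in>UNIV. \<Sum>u\<in>UNIV. \<Sum>v\<in>UNIV. p u * q v * \<bar>A $ u $ j - A $ v $ j\<bar>)"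
    proof (rule sum_mono)
      fix j
      have "\<bar>m * (x v* A) $ j\<bar> \<le> (\<Sum>u\<in>UNIV. \<bar>\<Sum>v\<in>UNIV. p u * q v * (A $ u $ j - A $ v $ j)\<bar>)"
        unfolding eq by (rule sum_abs)
      also have "\<dots> \<le> (\<Sum>u\<in>UNIV. \<Sum>v\<in>UNIV. \<bar>p u * q v * (A $ u $ j - A $ v $ j)\<bar>)"
        by (intro sum_mono sum_abs)
      finally show "\<bar>m * (x v* A) $ j\<bar> \<le> (\<Sum>u\<in>UNIV. \<Sum>v\<in>UNIV. p u * q v * \<bar>A $ u $ j - A $ v $ j\<bar>)"
        by (simp add: abs_mult pq)
    qed
    also have "\<dots> = (\<Sum>u\<in>UNIV. \<Sum>v\<in>UNIV. \<Sum>j\<in>UNIV. p u * q v * \<bar>A $ u $ j - A $ v $ j\<bar>)"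
      by (subst sum.swap) (intro sum.cong refl sum.swap)
    also have "\<dots> = (\<Sum>u\<in>UNIV. \<Sum>v\<in>UNIV. p u * q v * (2 * tv_dist (row u A) (row v A)))"
      by (simp add: tv_dist_def row_def sum_distrib_left)
    also have "\<dots> \<le> (\<Sum>u\<in>UNIV. \<Sum>v\<in>UNIV. p u * q v * (2 * D))"
      using D pq by (intro sum_mono mult_left_mono) auto
    also have "\<dots> = (\<Sum>u\<in>UNIV. p u) * (\<Sum>v\<in>UNIV. q v) * (2 * D)"
      unfolding sum_product by (simp only: sum_distrib_right)
    also have "\<dots> = m * (D * l1_norm x)"
      by (simp add: q nx m_def)
    finally show ?thesis using False m0 by simp
  qed
qed

section \<open>Powers of \<open>P\<close> applied to the perturbed invariant vector\<close>

lemma vector_matrix_pow_Suc: "x v* matrix_pow P (Suc t) = (x v* matrix_pow P t) v* P"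
  by (simp add: matrix_pow_def vector_matrix_mul_assoc)

lemma invariant_vector_matrix_pow:
  "invariant_vector P \<mu> \<Longrightarrow> \<mu> v* matrix_pow P t = \<mu>"
  by (induction t) (simp_all add: vector_matrix_pow_Suc invariant_vector_def, simp add: matrix_pow_def)

lemma row_eq_if_notin_row_supp:
  assumes "row_supp (Q - P) \<subseteq> W" "u \<notin> W"
  shows "Q $ u $ v = P $ u $ v"
proof -
  have "row u (Q - P) = 0" using assms by (auto simp: row_supp_def)
  then show ?thesis by (simp add: row_def vec_eq_iff)
qed

text \<open>Invariance turns the difference into \<open>\<mu> v* (P - Q)\<close>. Only rows in
  \<open>W\<close> survive, and two probability vectors are at \<open>l1\<close> distance at most
  2.\<close>

lemma l1_norm_one_step_perturbation:
  assumes "stochastic_matrix P" "stochastic_matrix Q" "prob_vector \<mu>" "invariant_vector Q \<mu>"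
    and supp: "row_supp (Q - P) \<subseteq> W"
  shows "l1_norm (\<mu> v* P - \<mu>) \<le> 2 * (\<Sum>w\<in>W. \<mu> $ w)"
proof -
  have "\<mu> v* P - \<mu> = \<mu> v* P - \<mu> v* Q"
    using assms(4) by (simp add: invariant_vector_def)
  also have "\<dots> = \<mu> v* (P - Q)"
    by (simp add: vec_eq_iff vector_matrix_mult_nth sum_subtractf algebra_simps)
  finally have "l1_norm (\<mu> v* P - \<mu>) \<le> (\<Sum>i\<in>UNIV. \<bar>\<mu> $ i\<bar> * l1_norm (row i (P - Q)))"
    using l1_norm_vector_matrix_mult_le by simp
  also have "\<dots> = (\<Sum>i\<in>W. \<bar>\<mu> $ i\<bar> * l1_norm (row i (P - Q)))"
  proof (rule sum.mono_neutral_right)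
    show "\<forall>i\<in>UNIV - W. \<bar>\<mu> $ i\<bar> * l1_norm (row i (P - Q)) = 0"
      by (simp add: l1_norm_def row_def row_eq_if_notin_row_supp[OF supp])
  qed auto
  also have "\<dots> \<le> (\<Sum>i\<in>W. \<mu> $ i * 2)"
  proof (rule sum_mono)
    fix i
    have "l1_norm (row i (P - Q)) = 2 * tv_dist (row i P) (row i Q)"
      by (simp add: tv_dist_def l1_norm_def row_def)
    then have "l1_norm (row i (P - Q)) \<le> 2"
      using tv_dist_le_1[OF prob_vector_row prob_vector_row] assms by force
    then show "\<bar>\<mu> $ i\<bar> * l1_norm (row i (P - Q)) \<le> \<mu> $ i * 2"
      using assms(3) by (auto simp: prob_vector_def intro!: mult_left_mono)
  qed
  finally show ?thesis by (simp add: sum_distrib_left mult.commute)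
qed

text \<open>The errors add up: the error of the first \<open>t\<close> steps is not enlarged by a
  further application of \<open>P\<close>, and this step contributes one more one-step
  error.\<close>

lemma l1_norm_multi_step_perturbation:
  assumes "stochastic_matrix P" "stochastic_matrix Q" "prob_vector \<mu>" "invariant_vector Q \<mu>"
    and "row_supp (Q - P) \<subseteq> W"
  shows "l1_norm (\<mu> v* matrix_pow P t - \<mu>) \<le> real t * (2 * (\<Sum>w\<in>W. \<mu> $ w))"
proof (induction t)
  case 0
  then show ?case by (simp add: matrix_pow_def l1_norm_def)
next
  case (Suc t)
  have "\<mu> v* matrix_pow P (Suc t) - \<mu> = (\<mu> v* matrix_pow P t - \<mu>) v* P + (\<mu> v* P - \<mu>)"
    by (simp add: vector_matrix_pow_Suc vec_eq_iff vector_matrix_mult_nth sum_subtractf algebra_simps)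
  then have "l1_norm (\<mu> v* matrix_pow P (Suc t) - \<mu>)
      \<le> l1_norm ((\<mu> v* matrix_pow P t - \<mu>) v* P) + l1_norm (\<mu> v* P - \<mu>)"
    by (simp only: l1_norm_triangle)
  also have "\<dots> \<le> l1_norm (\<mu> v* matrix_pow P t - \<mu>) + l1_norm (\<mu> v* P - \<mu>)"
    using l1_norm_stochastic_le[OF assms(1)] by (rule add_right_mono)
  also have "\<dots> \<le> real t * (2 * (\<Sum>w\<in>W. \<mu> $ w)) + 2 * (\<Sum>w\<in>W. \<mu> $ w)"
    using Suc l1_norm_one_step_perturbation[OF assms] by (rule add_mono)
  finally show ?case by (simp add: algebra_simps)
qed

lemma tv_dist_le_of_mixed:
  assumes "stochastic_matrix P" "stochastic_matrix Q" "prob_vector \<mu>" "invariant_vector Q \<mu>"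
    and "row_supp (Q - P) \<subseteq> W"
    and "prob_vector \<pi>" "invariant_vector P \<pi>"
    and mixed: "\<And>u v. tv_dist (row u (matrix_pow P t)) (row v (matrix_pow P t)) \<le> 1 / exp 1"
  shows "tv_dist \<mu> \<pi> \<le> 2 * (real t * (\<Sum>w\<in>W. \<mu> $ w))"
proof -
  define N where "N = l1_norm (\<mu> - \<pi>)"
  have "\<mu> - \<pi> = (\<mu> - \<pi>) v* matrix_pow P t + (\<mu> - \<mu> v* matrix_pow P t)"
    using invariant_vector_matrix_pow[OF assms(7), of t]
    by (simp add: vec_eq_iff vector_matrix_mult_nth sum_subtractf algebra_simps)
  then have "N \<le> l1_norm ((\<mu> - \<pi>) v* matrix_pow P t) + l1_norm (\<mu> v* matrix_pow P t - \<mu>)"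
    unfolding N_def by (metis l1_norm_triangle l1_norm_minus_commute)
  also have "l1_norm ((\<mu> - \<pi>) v* matrix_pow P t) \<le> 1 / exp 1 * N"
    unfolding N_def
    by (rule l1_norm_contraction[OF _ mixed])
      (use assms in \<open>simp add: prob_vector_def sum_subtractf\<close>)
  \<comment> \<open>Absorbing \<open>N / 2\<close> on the left gives \<open>N\<close> at most
    \<open>4 t\<close> times the mass of \<open>W\<close>. As \<open>tv_dist\<close> is half of
    \<open>N\<close>, the final factor is 2.\<close>
  also have "1 / exp 1 * N \<le> 1 / 2 * N"
    using exp_ge_add_one_self[of "1::real"] l1_norm_nonneg[of "\<mu> - \<pi>"]
    by (intro mult_right_mono) (auto simp: N_def field_simps)
  finally show ?thesis
    using l1_norm_multi_step_perturbation[OF assms(1-5), of t]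
    by (simp add: tv_dist_eq_l1_norm N_def)
qed

text \<open>An infimum of a nonempty set of naturals is attained by its least element, so the mixing
  bound holds at the mixing time itself.\<close>

lemma mixing_time_finite:
  assumes "mixing_time P \<noteq> \<infinity>"
  obtains t where "mixing_time P = of_nat t"
    "\<And>u v. tv_dist (row u (matrix_pow P t)) (row v (matrix_pow P t)) \<le> 1 / exp 1"
proof -
  define T where "T = {t::nat. 1 \<le> t \<and>
     (MAX (u, v) \<in> UNIV. tv_dist (row u (matrix_pow P t)) (row v (matrix_pow P t))) \<le> 1 / exp 1}"
  have eq: "mixing_time P = (INF t\<in>T. of_nat t)"
    by (simp add: mixing_time_def T_def)
  have "T \<noteq> {}" using assms by (auto simp: eq)
  then obtain s where s: "s \<in> T" by auto
  define t where "t = (LEAST t. t \<in> T)"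
  have t: "t \<in> T" "\<And>s. s \<in> T \<Longrightarrow> t \<le> s"
    unfolding t_def using s by (auto intro: LeastI Least_le)
  have "mixing_time P = of_nat t"
    unfolding eq using t by (intro antisym INF_lower INF_greatest) auto
  moreover have "tv_dist (row u (matrix_pow P t)) (row v (matrix_pow P t)) \<le> 1 / exp 1" for u v
  proof -
    have "tv_dist (row u (matrix_pow P t)) (row v (matrix_pow P t)) \<le>
       (MAX (u, v) \<in> UNIV. tv_dist (row u (matrix_pow P t)) (row v (matrix_pow P t)))"
      by (rule Max_ge) auto
    with t(1) show ?thesis by (auto simp: T_def)
  qed
  ultimately show ?thesis by (rule that)
qed

section \<open>First exit from \<open>W\<close> along finite paths\<close>

definition exit_at :: "real ^ 'v ^ 'v \<Rightarrow> 'v set \<Rightarrow> nat \<Rightarrow> 'v \<Rightarrow> real" where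
  "exit_at Q W k w = (\<Sum>\<xi> \<in> exit_paths W w k. \<Prod>l = 1..k. Q $ \<xi> (l - 1) $ \<xi> l)"

lemma finite_exit_paths: "finite (exit_paths W w k)" for w :: "'v :: finite"
  unfolding exit_paths_def by (rule finite_subset[OF _ finite_PiE[of "{..k}" "\<lambda>_. UNIV"]]) auto

text \<open>Paths are extensional on \<open>{..k}\<close>; for \<open>k = 1\<close> they take the
  value \<open>undefined\<close> from index 2 on, so the exit point determines the path.\<close>

lemma exit_paths_1: "exit_paths W w 1 = (\<lambda>v. case_nat w (case_nat v (\<lambda>_. undefined))) ` (- W)"
proof (intro set_eqI iffI)
  fix \<xi> assume "\<xi> \<in> exit_paths W w 1"
  then have \<xi>: "\<xi> 0 = w" "\<xi> 1 \<in> - W" "\<And>i. i > 1 \<Longrightarrow> \<xi> i = undefined"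
    by (auto simp: exit_paths_def PiE_def extensional_def)
  then have "\<xi> = case_nat w (case_nat (\<xi> 1) (\<lambda>_. undefined))"
    by (auto simp: fun_eq_iff split: nat.split)
  with \<xi>(2) show "\<xi> \<in> (\<lambda>v. case_nat w (case_nat v (\<lambda>_. undefined))) ` (- W)" by blast
qed (auto simp: exit_paths_def PiE_def extensional_def split: nat.split)

lemma exit_at_1: "exit_at Q W 1 w = (\<Sum>v\<in>-W. Q $ w $ v)"
proof -
  have "inj (\<lambda>v. case_nat w (case_nat v (\<lambda>_. undefined)))"
    by (rule injI) (drule fun_cong[of _ _ 1], simp)
  then show ?thesis
    unfolding exit_at_def exit_paths_1 by (subst sum.reindex) (auto intro: inj_on_subset)
qed

text \<open>Removing the initial state shifts a path by one. Since \<open>1 \<le> k\<close>, the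
  state at time 1 precedes the exit and hence lies in \<open>W\<close>.\<close>

lemma exit_paths_Suc:
  assumes "1 \<le> k"
  shows "exit_paths W w (Suc k) = case_nat w ` (\<Union>v\<in>W. exit_paths W v k)"
proof (intro set_eqI iffI)
  fix \<xi> assume \<xi>: "\<xi> \<in> exit_paths W w (Suc k)"
  define \<eta> where "\<eta> i = \<xi> (Suc i)" for i
  have "\<xi> = case_nat w \<eta>"
    using \<xi> by (auto simp: fun_eq_iff \<eta>_def exit_paths_def split: nat.split)
  moreover have "\<eta> \<in> exit_paths W (\<xi> 1) k" "\<xi> 1 \<in> W"
    using \<xi> assms by (auto simp: \<eta>_def exit_paths_def PiE_def extensional_def)
  ultimately show "\<xi> \<in> case_nat w ` (\<Union>v\<in>W. exit_paths W v k)" by blast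
next
  fix \<xi> assume "\<xi> \<in> case_nat w ` (\<Union>v\<in>W. exit_paths W v k)"
  then obtain v \<eta> where "v \<in> W" "\<eta> \<in> exit_paths W v k" "\<xi> = case_nat w \<eta>" by blast
  moreover from this have "\<eta> i \<in> W" if "i < k" for i
    using that by (cases i) (auto simp: exit_paths_def)
  ultimately show "\<xi> \<in> exit_paths W w (Suc k)"
    by (auto simp: exit_paths_def PiE_def extensional_def split: nat.split)
qed

text \<open>The Markov property at the first step.\<close>

lemma exit_at_Suc:
  assumes "1 \<le> k"
  shows "exit_at Q W (Suc k) w = (\<Sum>v\<in>W. Q $ w $ v * exit_at Q W k v)"
proof -
  have inj: "inj (case_nat w)"
    by (rule injI) (metis ext nat.case(2))
  have shift: "(\<Prod>l = 1..Suc k. Q $ case_nat w \<eta> (l - 1) $ case_nat w \<eta> l)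
      = Q $ w $ \<eta> 0 * (\<Prod>l = 1..k. Q $ \<eta> (l - 1) $ \<eta> l)" for \<eta>
  proof -
    have "(\<Prod>l = 1..Suc k. Q $ case_nat w \<eta> (l - 1) $ case_nat w \<eta> l)
        = (\<Prod>l = 0..k. Q $ case_nat w \<eta> l $ \<eta> l)"
      using prod.shift_bounds_cl_Suc_ivl[of "\<lambda>l. Q $ case_nat w \<eta> (l - 1) $ case_nat w \<eta> l" 0 k]
      by simp
    also have "\<dots> = Q $ w $ \<eta> 0 * (\<Prod>l = 1..k. Q $ case_nat w \<eta> l $ \<eta> l)"
      by (simp add: prod.atLeast_Suc_atMost)
    also have "(\<Prod>l = 1..k. Q $ case_nat w \<eta> l $ \<eta> l) = (\<Prod>l = 1..k. Q $ \<eta> (l - 1) $ \<eta> l)"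
      by (rule prod.cong) (auto split: nat.split)
    finally show ?thesis .
  qed
  have "exit_at Q W (Suc k) w
      = (\<Sum>\<eta> \<in> (\<Union>v\<in>W. exit_paths W v k). Q $ w $ \<eta> 0 * (\<Prod>l = 1..k. Q $ \<eta> (l - 1) $ \<eta> l))"
    unfolding exit_at_def exit_paths_Suc[OF assms]
    by (subst sum.reindex) (use inj shift in \<open>auto intro: inj_on_subset simp del: prod.cl_ivl_Suc\<close>)
  \<comment> \<open>The union is disjoint because a path determines its starting state
    \<open>v\<close>.\<close>
  also have "\<dots> = (\<Sum>v\<in>W. \<Sum>\<eta>\<in>exit_paths W v k. Q $ w $ \<eta> 0 * (\<Prod>l = 1..k. Q $ \<eta> (l - 1) $ \<eta> l))"
    by (rule sum.UNION_disjoint) (auto simp: finite_exit_paths, auto simp: exit_paths_def)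
  also have "\<dots> = (\<Sum>v\<in>W. Q $ w $ v * exit_at Q W k v)"
    unfolding exit_at_def sum_distrib_left
    by (intro sum.cong refl) (auto simp: exit_paths_def)
  finally show ?thesis .
qed

lemma exit_at_nonneg: "stochastic_matrix Q \<Longrightarrow> 0 \<le> exit_at Q W k w"
  unfolding exit_at_def by (intro sum_nonneg prod_nonneg) (auto simp: stochastic_matrix_def)

section \<open>Stationary flow out of \<open>W\<close> and the mass of \<open>W\<close>\<close>

definition exit_flow :: "real ^ 'v ^ 'v \<Rightarrow> real ^ 'v \<Rightarrow> 'v set \<Rightarrow> real" where
  "exit_flow Q \<mu> W = (\<Sum>w\<in>W. \<mu> $ w * (\<Sum>v\<in>-W. Q $ w $ v))"

text \<open>At \<open>k = 1\<close> this is an equality. In the induction, the mass reaching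
  \<open>v\<close> from \<open>W\<close> alone is at most \<open>\<mu> $ v\<close>, so one step more
  does not increase the sum.\<close>

lemma exit_at_stationary_le:
  assumes Q: "stochastic_matrix Q" and \<mu>: "prob_vector \<mu>" "invariant_vector Q \<mu>" and "1 \<le> k"
  shows "(\<Sum>w\<in>W. \<mu> $ w * exit_at Q W k w) \<le> exit_flow Q \<mu> W"
  using \<open>1 \<le> k\<close>
proof (induction k rule: dec_induct)
  case base
  then show ?case by (simp only: exit_at_1 exit_flow_def)
next
  case (step k)
  have "(\<Sum>w\<in>W. \<mu> $ w * exit_at Q W (Suc k) w)
      = (\<Sum>w\<in>W. \<Sum>v\<in>W. \<mu> $ w * Q $ w $ v * exit_at Q W k v)"
    by (simp add: exit_at_Suc[OF step(1)] sum_distrib_left mult.assoc)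
  also have "\<dots> = (\<Sum>v\<in>W. (\<Sum>w\<in>W. \<mu> $ w * Q $ w $ v) * exit_at Q W k v)"
    by (subst sum.swap) (simp add: sum_distrib_right)
  also have "\<dots> \<le> (\<Sum>v\<in>W. \<mu> $ v * exit_at Q W k v)"
  proof (intro sum_mono mult_right_mono exit_at_nonneg Q)
    fix v
    have "(\<Sum>w\<in>W. \<mu> $ w * Q $ w $ v) \<le> (\<mu> v* Q) $ v"
      unfolding vector_matrix_mult_nth
      using Q \<mu>(1) by (intro sum_mono2) (auto simp: stochastic_matrix_def prob_vector_def)
    then show "(\<Sum>w\<in>W. \<mu> $ w * Q $ w $ v) \<le> \<mu> $ v"
      using \<mu>(2) by (simp add: invariant_vector_def)
  qed
  finally show ?case using step by simp
qed

text \<open>The minimum over the states of positive mass is bounded by the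
  \<open>\<mu>\<close>-weighted average over \<open>W\<close>, as the other states have weight zero.
  The factor \<open>1 / t\<close> cancels the \<open>t\<close> summands, each at most the
  flow.\<close>

lemma exit_prob_le_flow:
  assumes Q: "stochastic_matrix Q" and \<mu>: "prob_vector \<mu>" "invariant_vector Q \<mu>"
  shows "ennreal (\<Sum>w\<in>W. \<mu> $ w) * exit_prob Q \<mu> W \<le> ennreal (exit_flow Q \<mu> W)"
proof -
  define g where "g t w = 1 / real t * (\<Sum>k = 1..t. exit_at Q W k w)" for t w
  define S where "S = {w \<in> W. 0 < \<mu> $ w}"
  have \<mu>0: "0 \<le> \<mu> $ w" for w using \<mu> by (simp add: prob_vector_def)
  have g0: "0 \<le> g t w" for t w
    using exit_at_nonneg[OF Q] by (auto simp: g_def intro!: divide_nonneg_nonneg sum_nonneg)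
  have *: "ennreal (\<Sum>w\<in>W. \<mu> $ w) * (INF w\<in>S. ennreal (g t w)) \<le> ennreal (exit_flow Q \<mu> W)"
    if t: "1 \<le> t" for t
  proof (cases "S = {}")
    \<comment> \<open>Here the infimum is infinite, but its factor is zero and
      \<open>0 * \<infinity> = 0\<close> in \<open>ennreal\<close>.\<close>
    case True
    then have "(\<Sum>w\<in>W. \<mu> $ w) = 0"
      using \<mu>0 by (intro sum.neutral) (force simp: S_def order.order_iff_strict)
    then show ?thesis by simp
  next
    case False
    then obtain w0 where w0: "w0 \<in> S" by auto
    have "(INF w\<in>S. ennreal (g t w)) \<le> ennreal (g t w0)"
      by (rule INF_lower[OF w0])
    then have "(INF w\<in>S. ennreal (g t w)) < \<infinity>"
      by (simp add: le_less_trans)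
    then obtain m where m: "0 \<le> m" "(INF w\<in>S. ennreal (g t w)) = ennreal m"
      by (cases "INF w\<in>S. ennreal (g t w)") auto
    have mg: "m \<le> g t w" if "w \<in> S" for w
      using INF_lower[OF that, of "\<lambda>w. ennreal (g t w)"] m g0 by simp
    have "(\<Sum>w\<in>W. \<mu> $ w) * m \<le> (\<Sum>w\<in>W. \<mu> $ w * g t w)"
      unfolding sum_distrib_right
    proof (rule sum_mono)
      fix w assume "w \<in> W"
      then show "\<mu> $ w * m \<le> \<mu> $ w * g t w"
        using \<mu>0[of w] mg[of w] by (cases "\<mu> $ w = 0") (auto simp: S_def)
    qed
    also have "\<dots> = 1 / real t * (\<Sum>w\<in>W. \<Sum>k = 1..t. \<mu> $ w * exit_at Q W k w)"
      by (simp add: g_def sum_distrib_left sum_divide_distrib)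
    also have "\<dots> = 1 / real t * (\<Sum>k = 1..t. \<Sum>w\<in>W. \<mu> $ w * exit_at Q W k w)"
      by (subst sum.swap) simp
    also have "\<dots> \<le> 1 / real t * (\<Sum>k = 1..t. exit_flow Q \<mu> W)"
      by (intro mult_left_mono sum_mono exit_at_stationary_le[OF Q \<mu>]) auto
    also have "\<dots> = exit_flow Q \<mu> W" using t by simp
    finally show ?thesis
      using m \<mu>0 by (simp add: ennreal_mult'[symmetric] sum_nonneg ennreal_leI)
  qed
  have "exit_prob Q \<mu> W = (SUP t\<in>{1..}. INF w\<in>S. ennreal (g t w))"
    by (simp add: exit_prob_def g_def S_def exit_at_def)
  then show ?thesis
    using * by (auto simp: SUP_mult_left_ennreal intro!: SUP_least)
qed

text \<open>Invariance of \<open>\<mu>\<close> is tested against the function \<open>\<tau>\<close>.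
  Outside \<open>W\<close> the rows of \<open>Q\<close> and \<open>P\<close> agree, so there
  \<open>Q\<close> lowers \<open>\<tau>\<close> by exactly 1.\<close>

lemma exit_flow_times_entrance_time_le:
  assumes Q: "stochastic_matrix Q" and \<mu>: "prob_vector \<mu>" "invariant_vector Q \<mu>"
    and supp: "row_supp (Q - P) \<subseteq> W" and \<tau>: "entrance_equations P W \<tau>"
    and c: "\<And>u. u \<notin> W \<Longrightarrow> c \<le> \<tau> u"
  shows "exit_flow Q \<mu> W * c \<le> 1"
proof -
  have rows: "Q $ u $ v = P $ u $ v" if "u \<notin> W" for u v
    using row_eq_if_notin_row_supp[OF supp that] by simp
  have \<mu>0: "0 \<le> \<mu> $ w" for w using \<mu> by (simp add: prob_vector_def)
  have Q0: "0 \<le> Q $ u $ v" for u v using Q by (simp add: stochastic_matrix_def)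
  have \<tau>W: "\<tau> u = 0" if "u \<in> W" for u
    using \<tau> that by (simp add: entrance_equations_def)
  have \<tau>C: "(\<Sum>v\<in>UNIV. Q $ u $ v * \<tau> v) = \<tau> u - 1" if "u \<in> - W" for u
    using \<tau> that rows by (simp add: entrance_equations_def)
  have split: "(\<Sum>v\<in>UNIV. f v) = (\<Sum>v\<in>W. f v) + (\<Sum>v\<in>-W. f v)" for f :: "'a \<Rightarrow> real"
    by (subst sum.union_disjoint[symmetric]) auto
  have "(\<Sum>v\<in>UNIV. \<mu> $ v * \<tau> v) = (\<Sum>v\<in>UNIV. (\<mu> v* Q) $ v * \<tau> v)"
    using \<mu>(2) by (simp add: invariant_vector_def)
  also have "\<dots> = (\<Sum>v\<in>UNIV. \<Sum>u\<in>UNIV. \<mu> $ u * (Q $ u $ v * \<tau> v))"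
    by (simp add: vector_matrix_mult_nth sum_distrib_right mult.assoc)
  also have "\<dots> = (\<Sum>u\<in>UNIV. \<mu> $ u * (\<Sum>v\<in>UNIV. Q $ u $ v * \<tau> v))"
    by (subst sum.swap) (simp add: sum_distrib_left)
  also have "\<dots> = (\<Sum>u\<in>W. \<mu> $ u * (\<Sum>v\<in>UNIV. Q $ u $ v * \<tau> v)) + (\<Sum>u\<in>-W. \<mu> $ u * (\<tau> u - 1))"
    by (simp only: split[of "\<lambda>u. \<mu> $ u * (\<Sum>v\<in>UNIV. Q $ u $ v * \<tau> v)"] \<tau>C cong: sum.cong)
  also have "(\<Sum>v\<in>UNIV. \<mu> $ v * \<tau> v) = (\<Sum>u\<in>-W. \<mu> $ u * \<tau> u)"
    by (subst split) (simp add: \<tau>W)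
  \<comment> \<open>The terms \<open>\<mu> $ u * \<tau> u\<close> outside \<open>W\<close> cancel:
    the flow out of \<open>W\<close>, weighted by the entrance times of its end points, equals the
    mass outside \<open>W\<close>.\<close>
  finally have balance: "(\<Sum>u\<in>W. \<mu> $ u * (\<Sum>v\<in>UNIV. Q $ u $ v * \<tau> v)) = (\<Sum>u\<in>-W. \<mu> $ u)"
    by (simp add: right_diff_distrib sum_subtractf)
  have "exit_flow Q \<mu> W * c = (\<Sum>u\<in>W. \<mu> $ u * (\<Sum>v\<in>-W. Q $ u $ v * c))"
    by (simp add: exit_flow_def sum_distrib_right sum_distrib_left mult.assoc)
  also have "\<dots> \<le> (\<Sum>u\<in>W. \<mu> $ u * (\<Sum>v\<in>-W. Q $ u $ v * \<tau> v))"
    using c by (intro sum_mono mult_left_mono \<mu>0 Q0) auto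
  also have "\<dots> = (\<Sum>u\<in>W. \<mu> $ u * (\<Sum>v\<in>UNIV. Q $ u $ v * \<tau> v))"
    by (simp add: split[of "\<lambda>v. Q $ _ $ v * \<tau> v"] \<tau>W)
  also have "\<dots> \<le> (\<Sum>u\<in>UNIV. \<mu> $ u)"
    unfolding balance by (rule sum_mono2) (auto simp: \<mu>0)
  finally show ?thesis using \<mu>(1) by (simp add: prob_vector_def)
qed

lemma stationary_mass_bound:
  assumes P: "stochastic_matrix P" "irreducible_matrix P" and Q: "stochastic_matrix Q"
    and \<mu>: "prob_vector \<mu>" "invariant_vector Q \<mu>" and supp: "row_supp (Q - P) \<subseteq> W"
  shows "ennreal (\<Sum>w\<in>W. \<mu> $ w) * (exit_prob Q \<mu> W * min_entrance_time P W) \<le> 1"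
proof (cases "W = {} \<or> W = UNIV")
  case True
  then show ?thesis
  proof
    \<comment> \<open>The minimal entrance time is infinite here, so the product of the other two
      factors has to be exactly zero.\<close>
    assume W: "W = UNIV"
    then have "exit_flow Q \<mu> W = 0" by (simp add: exit_flow_def)
    then have "ennreal (\<Sum>w\<in>W. \<mu> $ w) * exit_prob Q \<mu> W = 0"
      using exit_prob_le_flow[OF Q \<mu>, of W] by simp
    then show ?thesis by (simp only: mult.assoc[symmetric] mult_zero_left zero_le)
  qed simp
next
  case False
  then obtain u0 where u0: "u0 \<in> - W" by auto
  define \<tau> where "\<tau> = (THE \<tau>. entrance_equations P W \<tau>)"
  have \<tau>: "entrance_equations P W \<tau>"
    unfolding \<tau>_def by (rule theI'[OF entrance_equations_ex1[OF P]]) (use False in simp)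
  have \<tau>0: "0 \<le> \<tau> u" for u
    using entrance_equations_nonneg[OF P _ \<tau>] False by auto
  have le: "min_entrance_time P W \<le> ennreal (\<tau> u)" if "u \<in> - W" for u
    using INF_lower[OF that, of "entrance_time P W"] False
    by (simp add: min_entrance_time_def entrance_time_def \<tau>_def)
  \<comment> \<open>Finiteness comes from having a state outside the nonempty set \<open>W\<close>;
    it permits the passage to a real \<open>c\<close>.\<close>
  then have "min_entrance_time P W < \<infinity>"
    using u0 by (metis ennreal_less_top infinity_ennreal_def le_less_trans)
  then obtain c where c: "0 \<le> c" "min_entrance_time P W = ennreal c"
    by (cases "min_entrance_time P W") auto
  have "c \<le> \<tau> u" if "u \<notin> W" for u
    using le[of u] that c \<tau>0 by simp
  then have F: "exit_flow Q \<mu> W * c \<le> 1"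
    by (rule exit_flow_times_entrance_time_le[OF Q \<mu> supp \<tau>])
  have "ennreal (\<Sum>w\<in>W. \<mu> $ w) * exit_prob Q \<mu> W * ennreal c \<le> ennreal (exit_flow Q \<mu> W) * ennreal c"
    by (rule mult_right_mono[OF exit_prob_le_flow[OF Q \<mu>]]) simp
  also have "\<dots> = ennreal (exit_flow Q \<mu> W * c)"
    using c(1) by (simp add: ennreal_mult'')
  also have "\<dots> \<le> 1" using F by simp
  finally show ?thesis by (simp add: c mult.assoc)
qed

section \<open>Comparison with \<open>Psi\<close> and the final bound\<close>

lemma Psi_infinity: "Psi \<infinity> = 1"
  by (simp add: Psi_def top_unique)

text \<open>Up to the threshold, which is below 1, the logarithm is \<open>2 - ln r\<close> and thus
  at least 2; beyond it \<open>Psi\<close> is 1.\<close>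

lemma le_PsiI:
  assumes "d \<le> 1" "ennreal d \<le> 2 * x"
  shows "d \<le> Psi x"
proof (cases "x \<le> ennreal Psi_threshold")
  case True
  then obtain r where r: "x = ennreal r" "0 \<le> r"
    by (cases x) (auto simp: top_unique)
  with True Psi_threshold_works have "r < 1" by simp
  have "ennreal d \<le> ennreal (2 * r)"
    using assms(2) r by (simp add: ennreal_mult)
  then have d: "d \<le> 2 * r"
    using r(2) by (simp add: ennreal_le_iff)
  have "2 * r \<le> r * ln ((exp 1)\<^sup>2 / r)"
  proof (cases "r = 0")
    case False
    then have "2 \<le> ln ((exp 1)\<^sup>2 / r)"
      using r \<open>r < 1\<close> by (simp add: ln_div ln_realpow)
    then show ?thesis using r(2) by (simp add: mult.commute[of 2] mult_left_mono)
  qed simp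
  then show ?thesis using d True r by (simp add: Psi_def)
qed (use assms in \<open>simp add: Psi_def\<close>)

lemma ennreal_mult_le_divideI:
  fixes a b c :: ennreal
  assumes "a * c \<le> 1" "b \<noteq> 0" "b \<noteq> \<infinity>"
  shows "b * a \<le> b / c"
proof -
  have "a \<le> 1 / c"
  \<comment> \<open>For \<open>c = 0\<close> the quotient \<open>1 / c\<close> is infinite; for
    infinite \<open>c\<close> the hypothesis forces \<open>a = 0\<close>.\<close>
  proof (cases "c = 0 \<or> c = \<infinity>")
    case True
    then show ?thesis using assms(1) by (auto simp: ennreal_mult_eq_top_iff ennreal_mult_top top_unique split: if_splits)
  next
    case False
    then show ?thesis using assms(1)
      by (metis divide_right_mono_ennreal ennreal_mult_divide_eq infinity_ennreal_def)
  qed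
  then have "b * a \<le> b * (1 / c)" by (rule mult_left_mono) simp
  then show ?thesis by (simp add: ennreal_times_divide)
qed

theorem theorem3:
  fixes P Pt :: "real ^ 'v ^ 'v" and \<pi> \<pi>t :: "real ^ 'v" and W :: "'v set"
  assumes "stochastic_matrix P" and "stochastic_matrix Pt"
    and "irreducible_matrix P"
    and "prob_vector \<pi>" and "invariant_vector P \<pi>"
    and "prob_vector \<pi>t" and "invariant_vector Pt \<pi>t"
    and "row_supp (Pt - P) \<subseteq> W"
  shows "tv_dist \<pi>t \<pi> \<le>
    Psi (Psi_argument (mixing_time P) (exit_prob Pt \<pi>t W) (min_entrance_time P W))"
proof (cases "exit_prob Pt \<pi>t W = 0 \<or> mixing_time P = \<infinity>")
  case True
  \<comment> \<open>The argument of \<open>Psi\<close> is infinite, and the total variation distance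
    never exceeds 1.\<close>
  then show ?thesis
    using tv_dist_le_1 assms by (simp add: Psi_argument_def Psi_infinity[simplified])
next
  case False
  define c where "c = exit_prob Pt \<pi>t W * min_entrance_time P W"
  define p where "p = (\<Sum>w\<in>W. \<pi>t $ w)"
  have p0: "0 \<le> p"
    using assms by (auto simp: p_def prob_vector_def intro: sum_nonneg)
  from False obtain t where t: "mixing_time P = of_nat t"
    and mixed: "\<And>u v. tv_dist (row u (matrix_pow P t)) (row v (matrix_pow P t)) \<le> 1 / exp 1"
    using mixing_time_finite by blast
  have "tv_dist \<pi>t \<pi> \<le> 2 * (real t * p)"
    unfolding p_def using assms mixed by (intro tv_dist_le_of_mixed) auto
  then have "ennreal (tv_dist \<pi>t \<pi>) \<le> ennreal (2 * (real t * p))"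
    by (rule ennreal_leI)
  also have "\<dots> = 2 * (mixing_time P * ennreal p)"
    using p0 by (simp add: t ennreal_mult ennreal_of_nat_eq_real_of_nat)
  also have "\<dots> \<le> 2 * (mixing_time P / c)"
  proof (intro mult_left_mono)
    show "mixing_time P * ennreal p \<le> mixing_time P / c"
    \<comment> \<open>In the zero case the left side vanishes; otherwise the division lemma applies,
      the mixing time being a natural number and hence finite.\<close>
    proof (cases "mixing_time P = 0")
      case False
      show ?thesis
      proof (rule ennreal_mult_le_divideI)
        show "ennreal p * c \<le> 1"
          unfolding p_def c_def using assms by (intro stationary_mass_bound) auto
      qed (use False t in auto)
    qed simp
  qed simp
  finally show ?thesis
    using False tv_dist_le_1 assms by (intro le_PsiI) (auto simp: Psi_argument_def c_def)
qed

end
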